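(* Let $\mathbb{K}$ be a field and let $\Delta$ be a $\mathbb{K}$-spherical complex with the homology (over $\mathbb{K}$) of a sphere of dimension $d_\Delta$. Let $\Sigma$ be a subcomplex of $\Delta$ such that $\Sigma=\Delta(X\mid Y)$, where $X,Y$ are disjoint subsets of the vertex set of $\Delta$. Then $\Sigma$ either has no (reduced) homology or has the homology of a sphere of dimension $d_\Sigma$, where $$d_\Delta-|X|-|Y|\le d_\Sigma\le d_\Delta.$$
   Context: All simplicial complexes are finite; a vertex of $\Delta$ is an element $v$ with $\{v\}\in\Delta$. The complex $\{\emptyset\}$ has the homology of a $(-1)$-sphere ($\tilde H_{-1}\cong\mathbb{K}$); the void complex $\{\}$ has zero homology. "Having the homology of a $k$-dimensional sphere" ($k\ge -1$) means $\tilde H_k\cong\mathbb{K}$ and $\tilde H_j=0$ for $j\ne k$, coefficients in $\mathbb{K}$. For a vertex $v$ of $\Delta$, $\mathrm{del}_\Delta(v)=\{\sigma\in\Delta: v\notin\sigma\}$ and $\mathrm{link}_\Delta(v)=\{\sigma\in\mathrm{del}_\Delta(v):\sigma\cup\{v\}\in\Delta\}$; if $w$ is not a vertex of $\Delta$, set $\mathrm{del}_\Delta(w)=\Delta$ and $\mathrm{link}_\Delta(w)=\{\}$. A simplicial complex $\Delta$ is $\mathbb{K}$-spherical if (recursively) (i) $\tilde H_i(\Delta;\mathbb{K})$ is one-dimensional for at most one $i$ and is zero for all other $i$; and (ii) for every vertex $v$ of $\Delta$ both $\mathrm{link}_\Delta(v)$ and $\mathrm{del}_\Delta(v)$ are $\mathbb{K}$-spherical.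 For disjoint vertex sets $X,Y$ with $X\cup Y=\{v_1,\dots,v_n\}$, put $\Delta_1=\Delta$ and, for $i\ge1$, $\Delta_{i+1}=\mathrm{link}_{\Delta_i}(v_i)$ if $v_i\in X$ and $\Delta_{i+1}=\mathrm{del}_{\Delta_i}(v_i)$ if $v_i\in Y$. Then $\Delta(X\mid Y):=\Delta_{n+1}$ (this does not depend on the ordering). *)

theory Defs
  imports Complex_Main
begin

text \<open>Both the void complex \<open>{}\<close> and \<open>{{}}\<close> are simplicial complexes.\<close>

definition simplicial_complex :: "'a set set \<Rightarrow> bool" where
  "simplicial_complex \<Delta> \<longleftrightarrow>
     finite \<Delta> \<and> (\<forall>\<sigma>\<in>\<Delta>. finite \<sigma> \<and> (\<forall>\<tau>. \<tau> \<subseteq> \<sigma> \<longrightarrow> \<tau> \<in> \<Delta>))"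

definition vertices :: "'a set set \<Rightarrow> 'a set" where
  "vertices \<Delta> = {v. {v} \<in> \<Delta>}"

text \<open>For a simplicial complex and a non-vertex \<open>v\<close> these give \<open>\<Delta>\<close> and \<open>{}\<close>,
  respectively.\<close>

definition del :: "'a set set \<Rightarrow> 'a \<Rightarrow> 'a set set" where
  "del \<Delta> v = {\<sigma> \<in> \<Delta>. v \<notin> \<sigma>}"

definition link :: "'a set set \<Rightarrow> 'a \<Rightarrow> 'a set set" where
  "link \<Delta> v = {\<sigma> \<in> del \<Delta> v. \<sigma> \<union> {v} \<in> \<Delta>}"


section \<open>Reduced simplicial homology over a field\<close>

text \<open>Simplices are oriented by an arbitrary total order on the vertex type, fixed once and for
  all by choice; up to isomorphism, homology does not depend on it.\<close>

definition vertex_order :: "'a rel" where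
  "vertex_order = (SOME r. linear_order_on UNIV r)"

lemma linear_order_vertex_order: "linear_order_on UNIV (vertex_order :: 'a rel)"
proof -
  have "\<exists>r :: 'a rel. linear_order_on UNIV r"
    using well_order_on[of "UNIV :: 'a set"] unfolding well_order_on_def by blast
  then show ?thesis
    unfolding vertex_order_def by (rule someI_ex)
qed

text \<open>A \<open>k\<close>-chain is given by its coefficients; the empty face spans the chains of degree
  \<open>-1\<close>, which makes the homology reduced.\<close>

definition chains :: "'a set set \<Rightarrow> int \<Rightarrow> ('a set \<Rightarrow> 'k::field) set" where
  "chains \<Delta> k = {c. \<forall>\<sigma>. c \<sigma> \<noteq> 0 \<longrightarrow> \<sigma> \<in> \<Delta> \<and> int (card \<sigma>) = k + 1}"

text \<open>The boundary of the simplex with vertices \<open>v\<^sub>0 < \<dots> < v\<^sub>k\<close> is the alternating sum of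
  \<open>(-1)^i\<close> times the face omitting \<open>v\<^sub>i\<close>.  Hence the coefficient of \<open>\<tau>\<close> in the boundary of \<open>c\<close>
  collects the coefficients of all \<open>\<tau> \<union> {v}\<close>, where the sign is determined by the number of
  vertices of \<open>\<tau>\<close> preceding \<open>v\<close>.\<close>

definition boundary :: "'a set set \<Rightarrow> ('a set \<Rightarrow> 'k::field) \<Rightarrow> 'a set \<Rightarrow> 'k" where
  "boundary \<Delta> c \<tau> =
     (\<Sum>v | v \<notin> \<tau> \<and> insert v \<tau> \<in> \<Delta>.
        (-1) ^ card {u \<in> \<tau>. (u, v) \<in> vertex_order} * c (insert v \<tau>))"

definition cycles :: "'a set set \<Rightarrow> int \<Rightarrow> ('a set \<Rightarrow> 'k::field) set" where
  "cycles \<Delta> k = {c \<in> chains \<Delta> k. boundary \<Delta> c = (\<lambda>_. 0)}"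

definition boundaries :: "'a set set \<Rightarrow> int \<Rightarrow> ('a set \<Rightarrow> 'k::field) set" where
  "boundaries \<Delta> k = boundary \<Delta> ` chains \<Delta> (k + 1)"

text \<open>The homology space is the quotient of the cycles by the boundaries, realised as a set of
  cosets with the induced addition and scalar multiplication.\<close>

definition homology_class ::
    "'a set set \<Rightarrow> int \<Rightarrow> ('a set \<Rightarrow> 'k::field) \<Rightarrow> ('a set \<Rightarrow> 'k) set" where
  "homology_class \<Delta> k z = {(\<lambda>\<sigma>. z \<sigma> + b \<sigma>) | b. b \<in> boundaries \<Delta> k}"

definition homology :: "'a set set \<Rightarrow> int \<Rightarrow> ('a set \<Rightarrow> 'k::field) set set" where
  "homology \<Delta> k = homology_class \<Delta> k ` cycles \<Delta> k"

definition class_add ::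
    "('a set \<Rightarrow> 'k::field) set \<Rightarrow> ('a set \<Rightarrow> 'k) set \<Rightarrow> ('a set \<Rightarrow> 'k) set" where
  "class_add A B = {(\<lambda>\<sigma>. a \<sigma> + b \<sigma>) | a b. a \<in> A \<and> b \<in> B}"

text \<open>For \<open>r = 0\<close>, multiplying the members of a coset by \<open>r\<close> gives only the zero chain; taking
  the cosets of the multiples gives the right result for every \<open>r\<close>.\<close>

definition class_scale ::
    "'a set set \<Rightarrow> int \<Rightarrow> 'k::field \<Rightarrow> ('a set \<Rightarrow> 'k) set \<Rightarrow> ('a set \<Rightarrow> 'k) set" where
  "class_scale \<Delta> k r A = (\<Union>a\<in>A. homology_class \<Delta> k (\<lambda>\<sigma>. r * a \<sigma>))"

definition homology_zero :: "'k::field itself \<Rightarrow> 'a set set \<Rightarrow> int \<Rightarrow> bool" where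
  "homology_zero K \<Delta> k \<longleftrightarrow>
     (homology \<Delta> k :: ('a set \<Rightarrow> 'k) set set) = {homology_class \<Delta> k (\<lambda>_. 0)}"

text \<open>There is a linear isomorphism from the homology space onto the field.\<close>

definition homology_one_dim :: "'k::field itself \<Rightarrow> 'a set set \<Rightarrow> int \<Rightarrow> bool" where
  "homology_one_dim K \<Delta> k \<longleftrightarrow>
     (\<exists>\<phi> :: ('a set \<Rightarrow> 'k) set \<Rightarrow> 'k.
        bij_betw \<phi> (homology \<Delta> k) UNIV \<and>
        (\<forall>A\<in>homology \<Delta> k. \<forall>B\<in>homology \<Delta> k. \<phi> (class_add A B) = \<phi> A + \<phi> B) \<and>
        (\<forall>r. \<forall>A\<in>homology \<Delta> k. \<phi> (class_scale \<Delta> k r A) = r * \<phi> A))"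

definition no_homology :: "'k::field itself \<Rightarrow> 'a set set \<Rightarrow> bool" where
  "no_homology K \<Delta> \<longleftrightarrow> (\<forall>k. homology_zero K \<Delta> k)"

definition sphere_homology :: "'k::field itself \<Rightarrow> 'a set set \<Rightarrow> int \<Rightarrow> bool" where
  "sphere_homology K \<Delta> d \<longleftrightarrow>
     d \<ge> -1 \<and> homology_one_dim K \<Delta> d \<and> (\<forall>j. j \<noteq> d \<longrightarrow> homology_zero K \<Delta> j)"


section \<open>Spherical complexes\<close>

text \<open>The recursion terminates, because \<open>link \<Delta> v\<close> and \<open>del \<Delta> v\<close> have fewer faces than \<open>\<Delta>\<close>
  when \<open>v\<close> is a vertex; hence the least predicate below is the one given by the recursion.\<close>

inductive spherical :: "'k::field itself \<Rightarrow> 'a set set \<Rightarrow> bool" for K :: "'k::field itself" where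
  "spherical K \<Delta>"
  if "simplicial_complex \<Delta>"
    and "\<forall>i. homology_zero K \<Delta> i \<or> homology_one_dim K \<Delta> i"
    and "\<forall>i j. homology_one_dim K \<Delta> i \<and> homology_one_dim K \<Delta> j \<longrightarrow> i = j"
    and "\<forall>v\<in>vertices \<Delta>. spherical K (link \<Delta> v) \<and> spherical K (del \<Delta> v)"

text \<open>With \<open>vs\<close> enumerating \<open>X \<union> Y\<close> for disjoint \<open>X\<close> and \<open>Y\<close>, this is \<open>\<Delta>(X | Y)\<close>, computed in
  the order \<open>vs\<close>: vertices in \<open>X\<close> are linked, the others (those in \<open>Y\<close>) are deleted.\<close>

primrec link_del :: "'a set \<Rightarrow> 'a list \<Rightarrow> 'a set set \<Rightarrow> 'a set set" where
  "link_del X [] \<Delta> = \<Delta>"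
| "link_del X (v # vs) \<Delta> = link_del X vs (if v \<in> X then link \<Delta> v else del \<Delta> v)"

end

theory Submission
  imports Defs
begin

text \<open>For a vertex \<open>v\<close>, the complex \<open>\<Delta>\<close> is the deletion of \<open>v\<close> with a cone over the link of \<open>v\<close>
  attached, so there is a long exact sequence
  \<open>\<dots> \<rightarrow> H\<^sub>k(link) \<rightarrow> H\<^sub>k(del) \<rightarrow> H\<^sub>k(\<Delta>) \<rightarrow> H\<^sub>k\<^sub>-\<^sub>1(link) \<rightarrow> \<dots>\<close>.
  A spherical complex has homology in at most one degree, and there it is one-dimensional.  For such
  complexes it therefore suffices to know in which degrees the homology vanishes, and the only part
  of exactness that matters is that a term between two vanishing terms vanishes
  (\<open>homology_zero_link\<close>, \<open>homology_zero_del\<close>, \<open>homology_zero_from_link_del\<close>).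

  Two consequences follow.  If \<open>\<Delta>\<close> has no homology, then link and deletion have homology in the
  same degrees.  If \<open>\<Delta>\<close> is a homology \<open>d\<close>-sphere, then link and deletion have homology at most in
  the degrees \<open>d\<close> and \<open>d - 1\<close>, and not both are acyclic.

  The bound follows by induction on the number of vertices (\<open>iterated_link_del_degree\<close>).  An
  intermediate complex may be acyclic and a later one a sphere again, so following the degree from
  \<open>\<Delta>\<close> to \<open>\<Sigma>\<close> step by step does not work.  Instead, take one vertex \<open>v\<close>, and let \<open>\<Gamma>\<close> arise from
  \<open>\<Delta>\<close> by the operations at all other vertices.  The operations at different vertices commute, so
  \<open>\<Sigma>\<close> is the link or the deletion of \<open>v\<close> in \<open>\<Gamma>\<close>.  If \<open>\<Gamma>\<close> is a sphere, its degree is controlled by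
  induction, and that of \<open>\<Sigma>\<close> is at most one smaller.  If \<open>\<Gamma>\<close> is acyclic, then \<open>\<Sigma>\<close> has the
  homology of its sibling, the other one of link and deletion of \<open>v\<close> in \<open>\<Gamma>\<close>; and one of the two
  arises, by the remaining operations, from a link or deletion of \<open>v\<close> in \<open>\<Delta>\<close> that is a sphere of
  dimension \<open>d\<close> or \<open>d - 1\<close>, so that the induction hypothesis applies to it.\<close>


section \<open>Links and deletions\<close>

lemma simplicial_complex_del:
  "simplicial_complex \<Delta> \<Longrightarrow> simplicial_complex (del \<Delta> v)"
  unfolding simplicial_complex_def del_def by auto

lemma simplicial_complex_link:
  assumes "simplicial_complex \<Delta>"
  shows "simplicial_complex (link \<Delta> v)"
proof -
  have sub: "link \<Delta> v \<subseteq> \<Delta>" by (auto simp: link_def del_def)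
  have "\<tau> \<in> link \<Delta> v" if "\<sigma> \<in> link \<Delta> v" "\<tau> \<subseteq> \<sigma>" for \<sigma> \<tau>
  proof -
    have "\<tau> \<union> {v} \<subseteq> \<sigma> \<union> {v}" using that by auto
    with that assms show ?thesis
      unfolding simplicial_complex_def link_def del_def by blast
  qed
  moreover have "finite (link \<Delta> v)"
    using assms finite_subset[OF sub] by (simp add: simplicial_complex_def)
  moreover have "finite \<sigma>" if "\<sigma> \<in> link \<Delta> v" for \<sigma>
    using assms sub that by (auto simp: simplicial_complex_def)
  ultimately show ?thesis by (simp add: simplicial_complex_def)
qed

lemma link_nonvertex:
  "simplicial_complex \<Delta> \<Longrightarrow> v \<notin> vertices \<Delta> \<Longrightarrow> link \<Delta> v = {}"
  unfolding simplicial_complex_def vertices_def link_def by fastforce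

lemma del_nonvertex:
  "simplicial_complex \<Delta> \<Longrightarrow> v \<notin> vertices \<Delta> \<Longrightarrow> del \<Delta> v = \<Delta>"
  unfolding simplicial_complex_def vertices_def del_def by fastforce

lemma link_link: "v \<noteq> w \<Longrightarrow> link (link \<Delta> v) w = link (link \<Delta> w) v"
  unfolding link_def del_def by (auto simp: insert_commute)

lemma del_del: "del (del \<Delta> v) w = del (del \<Delta> w) v"
  unfolding del_def by auto

lemma link_del_commute: "v \<noteq> w \<Longrightarrow> link (del \<Delta> v) w = del (link \<Delta> w) v"
  unfolding link_def del_def by auto

lemma link_del_of_link:
  "v \<notin> set vs \<Longrightarrow> link_del X vs (link \<Delta> v) = link (link_del X vs \<Delta>) v"
proof (induction vs arbitrary: \<Delta>)
  case (Cons w vs)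
  then show ?case by (auto simp: link_link[of v w] simp flip: link_del_commute[of w v])
qed simp

lemma link_del_of_del:
  "v \<notin> set vs \<Longrightarrow> link_del X vs (del \<Delta> v) = del (link_del X vs \<Delta>) v"
proof (induction vs arbitrary: \<Delta>)
  case (Cons w vs)
  then show ?case by (simp add: del_del[of _ v w] link_del_commute[of v w])
qed simp


section \<open>Chains and boundaries\<close>

lemma chains_zero: "(\<lambda>_. 0) \<in> chains \<Delta> k"
  by (simp add: chains_def)

lemma chains_add: "a \<in> chains \<Delta> k \<Longrightarrow> b \<in> chains \<Delta> k \<Longrightarrow> (\<lambda>\<sigma>. a \<sigma> + b \<sigma>) \<in> chains \<Delta> k"
  unfolding chains_def by (smt (verit) add.right_neutral mem_Collect_eq)

lemma chains_uminus: "a \<in> chains \<Delta> k \<Longrightarrow> (\<lambda>\<sigma>. - a \<sigma>) \<in> chains \<Delta> k"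
  unfolding chains_def by simp

lemma chains_mono: "a \<in> chains \<Delta> k \<Longrightarrow> \<Delta> \<subseteq> \<Gamma> \<Longrightarrow> a \<in> chains \<Gamma> k"
  unfolding chains_def by auto

lemma chains_outside: "a \<in> chains \<Delta> k \<Longrightarrow> \<sigma> \<notin> \<Delta> \<Longrightarrow> a \<sigma> = 0"
  unfolding chains_def by auto

lemma link_subset_del: "link \<Delta> v \<subseteq> del \<Delta> v"
  by (auto simp: link_def)

lemma boundary_zero: "boundary \<Delta> (\<lambda>_. 0) = (\<lambda>_. 0)"
  by (simp add: boundary_def fun_eq_iff)

lemma boundary_add:
  "boundary \<Delta> (\<lambda>\<sigma>. a \<sigma> + b \<sigma>) = (\<lambda>\<tau>. boundary \<Delta> a \<tau> + boundary \<Delta> b \<tau>)"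
  by (simp add: boundary_def fun_eq_iff distrib_left sum.distrib)

lemma boundary_uminus: "boundary \<Delta> (\<lambda>\<sigma>. - a \<sigma>) = (\<lambda>\<tau>. - boundary \<Delta> a \<tau>)"
  by (simp add: boundary_def fun_eq_iff sum_negf)

lemma finite_cofaces:
  assumes "simplicial_complex \<Delta>"
  shows "finite {w. w \<notin> \<tau> \<and> insert w \<tau> \<in> \<Delta>}"
proof (rule finite_subset)
  show "{w. w \<notin> \<tau> \<and> insert w \<tau> \<in> \<Delta>} \<subseteq> \<Union>\<Delta>" by auto
  show "finite (\<Union>\<Delta>)" using assms by (auto simp: simplicial_complex_def)
qed

lemma boundary_mono:
  assumes "simplicial_complex \<Gamma>" "\<Delta> \<subseteq> \<Gamma>" "a \<in> chains \<Delta> k"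
  shows "boundary \<Gamma> a = boundary \<Delta> a"
proof
  fix \<tau>
  show "boundary \<Gamma> a \<tau> = boundary \<Delta> a \<tau>"
    unfolding boundary_def using assms(2) chains_outside[OF assms(3)]
    by (intro sum.mono_neutral_right finite_cofaces[OF assms(1)]) auto
qed

lemma boundary_chains:
  assumes "simplicial_complex \<Delta>" "c \<in> chains \<Delta> k"
  shows "boundary \<Delta> c \<in> chains \<Delta> (k - 1)"
proof -
  have "\<tau> \<in> \<Delta> \<and> int (card \<tau>) = k - 1 + 1" if nz: "boundary \<Delta> c \<tau> \<noteq> 0" for \<tau>
  proof -
    obtain w where w: "w \<notin> \<tau>" "insert w \<tau> \<in> \<Delta>" "c (insert w \<tau>) \<noteq> 0"
      using nz unfolding boundary_def by (metis (mono_tags, lifting) mem_Collect_eq mult_zero_right sum.neutral)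
    then have "finite (insert w \<tau>)" "\<tau> \<in> \<Delta>"
      using assms(1) unfolding simplicial_complex_def by (blast, blast)
    moreover have "int (card (insert w \<tau>)) = k + 1"
      using assms(2) w unfolding chains_def by auto
    ultimately show ?thesis using w by simp
  qed
  then show ?thesis by (simp add: chains_def)
qed

lemma boundaries_add:
  assumes "a \<in> boundaries \<Delta> k" "b \<in> boundaries \<Delta> k"
  shows "(\<lambda>\<sigma>. a \<sigma> + b \<sigma>) \<in> boundaries \<Delta> k"
proof -
  obtain a' b' where "a' \<in> chains \<Delta> (k+1)" "b' \<in> chains \<Delta> (k+1)"
    "a = boundary \<Delta> a'" "b = boundary \<Delta> b'"
    using assms unfolding boundaries_def by auto
  then show ?thesis
    unfolding boundaries_def by (intro image_eqI[of _ _ "\<lambda>\<sigma>. a' \<sigma> + b' \<sigma>"] chains_add)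
      (simp_all add: boundary_add)
qed

lemma boundaries_uminus:
  assumes "a \<in> boundaries \<Delta> k"
  shows "(\<lambda>\<sigma>. - a \<sigma>) \<in> boundaries \<Delta> k"
proof -
  obtain a' where "a' \<in> chains \<Delta> (k+1)" "a = boundary \<Delta> a'"
    using assms unfolding boundaries_def by auto
  then show ?thesis
    unfolding boundaries_def by (intro image_eqI[OF _ chains_uminus]) (simp_all add: boundary_uminus)
qed

lemma cycles_zero: "(\<lambda>_. 0) \<in> cycles \<Delta> k"
  by (simp add: cycles_def boundary_zero chains_zero)

lemma boundaries_zero: "(\<lambda>_. 0) \<in> boundaries \<Delta> k"
  unfolding boundaries_def by (rule image_eqI[OF _ chains_zero]) (simp add: boundary_zero)

lemma homology_zero_iff:
  fixes K :: "'k::field itself"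
  shows "homology_zero K \<Delta> k \<longleftrightarrow>
    (cycles \<Delta> k :: ('a set \<Rightarrow> 'k) set) \<subseteq> boundaries \<Delta> k"
proof
  assume z: "homology_zero K \<Delta> k"
  show "(cycles \<Delta> k :: ('a set \<Rightarrow> 'k) set) \<subseteq> boundaries \<Delta> k"
  proof
    fix c :: "'a set \<Rightarrow> 'k" assume "c \<in> cycles \<Delta> k"
    then have "homology_class \<Delta> k c = homology_class \<Delta> k (\<lambda>_. 0)"
      using z unfolding homology_zero_def homology_def by blast
    moreover have "c \<in> homology_class \<Delta> k c"
      unfolding homology_class_def using boundaries_zero[of \<Delta> k] by force
    ultimately show "c \<in> boundaries \<Delta> k" by (auto simp: homology_class_def)
  qed
next
  assume sub: "(cycles \<Delta> k :: ('a set \<Rightarrow> 'k) set) \<subseteq> boundaries \<Delta> k"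
  have "homology_class \<Delta> k c = homology_class \<Delta> k (\<lambda>_. 0)"
    if "c \<in> boundaries \<Delta> k" for c :: "'a set \<Rightarrow> 'k"
  proof -
    have "\<exists>b'. (\<lambda>\<sigma>. b \<sigma>) = (\<lambda>\<sigma>. c \<sigma> + b' \<sigma>) \<and> b' \<in> boundaries \<Delta> k"
      if "b \<in> boundaries \<Delta> k" for b
      using boundaries_add[OF boundaries_uminus[OF \<open>c \<in> boundaries \<Delta> k\<close>] that]
      by (intro exI[of _ "\<lambda>\<sigma>. - c \<sigma> + b \<sigma>"]) simp
    then show ?thesis
      using boundaries_add[OF that] unfolding homology_class_def by auto
  qed
  then have "homology_class \<Delta> k ` cycles \<Delta> k = {homology_class \<Delta> k (\<lambda>_. 0 :: 'k)}"
    using sub cycles_zero[of \<Delta> k] by blast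
  then show "homology_zero K \<Delta> k"
    by (simp add: homology_zero_def homology_def)
qed

lemma homology_zeroD:
  fixes K :: "'k::field itself" and c :: "'a set \<Rightarrow> 'k"
  assumes "homology_zero K \<Delta> k" "c \<in> chains \<Delta> k" "boundary \<Delta> c = (\<lambda>_. 0)"
  obtains e where "e \<in> chains \<Delta> (k + 1)" "boundary \<Delta> e = c"
  using assms unfolding homology_zero_iff cycles_def boundaries_def by blast

lemma homology_zeroI:
  fixes K :: "'k::field itself"
  assumes "\<And>c :: 'a set \<Rightarrow> 'k. c \<in> chains \<Delta> k \<Longrightarrow> boundary \<Delta> c = (\<lambda>_. 0) \<Longrightarrow>
    \<exists>e \<in> chains \<Delta> (k + 1). boundary \<Delta> e = c"
  shows "homology_zero K \<Delta> k"
  using assms unfolding homology_zero_iff cycles_def boundaries_def by blast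


section \<open>The long exact sequence of a vertex\<close>

definition face_sign :: "'a \<Rightarrow> 'a set \<Rightarrow> 'k::field" where
  "face_sign v \<tau> = (-1) ^ card {u \<in> \<tau>. (u, v) \<in> vertex_order}"

lemma face_sign_square: "face_sign v \<tau> * (face_sign v \<tau> * x) = (x :: 'k::field)"
  by (simp add: face_sign_def flip: mult.assoc power_mult_distrib)

lemma boundary_face_sign:
  "boundary \<Delta> c \<tau> = (\<Sum>v | v \<notin> \<tau> \<and> insert v \<tau> \<in> \<Delta>. face_sign v \<tau> * c (insert v \<tau>))"
  by (simp add: boundary_def face_sign_def)

text \<open>This is the reason why \<open>\<partial>\<partial> = 0\<close>: inserting \<open>v\<close> and \<open>w\<close> in the two possible orders gives opposite
  signs, because exactly one of them precedes the other.\<close>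

lemma face_sign_swap:
  assumes "v \<noteq> w" "finite \<tau>" "v \<notin> \<tau>" "w \<notin> \<tau>"
  shows "face_sign w (insert v \<tau>) * face_sign v (insert w \<tau>) =
    - (face_sign v \<tau> * face_sign w \<tau> :: 'k::field)"
proof -
  have ins: "face_sign y (insert x \<tau>) =
      (if (x, y) \<in> vertex_order then -1 else 1) * (face_sign y \<tau> :: 'k)"
    if "x \<notin> \<tau>" for x y
  proof -
    have "{u \<in> insert x \<tau>. (u, y) \<in> vertex_order} =
      (if (x, y) \<in> vertex_order then insert x {u \<in> \<tau>. (u, y) \<in> vertex_order}
       else {u \<in> \<tau>. (u, y) \<in> vertex_order})" by auto
    then show ?thesis using that assms(2) by (simp add: face_sign_def)
  qed
  have "(v, w) \<in> vertex_order \<longleftrightarrow> (w, v) \<notin> vertex_order"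
    using linear_order_vertex_order[where 'a='a] assms(1)
    unfolding linear_order_on_def partial_order_on_def total_on_def antisym_def by blast
  then show ?thesis using assms by (auto simp: ins)
qed

text \<open>A chain of \<open>\<Delta>\<close> amounts to a pair \<open>(a, b)\<close>: \<open>a\<close>, a chain of the deletion, is its part on the
  faces without \<open>v\<close>, and \<open>b\<close>, a chain of the link of degree one less, describes its part on the faces
  containing \<open>v\<close>.  The sign makes the boundary of \<open>(a, b)\<close> equal to \<open>(\<partial>a + b, -\<partial>b)\<close>, as in the
  mapping cone of the inclusion of the link into the deletion.\<close>

definition cone_chain ::
    "'a \<Rightarrow> ('a set \<Rightarrow> 'k::field) \<Rightarrow> ('a set \<Rightarrow> 'k) \<Rightarrow> 'a set \<Rightarrow> 'k" where
  "cone_chain v a b \<sigma> = (if v \<in> \<sigma> then face_sign v (\<sigma> - {v}) * b (\<sigma> - {v}) else a \<sigma>)"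

lemma cone_chain_zero: "cone_chain v (\<lambda>_. 0) (\<lambda>_. 0) = (\<lambda>_. 0)"
  by (simp add: cone_chain_def fun_eq_iff)

lemma cone_chain_chains:
  assumes \<Delta>: "simplicial_complex \<Delta>"
    and a: "a \<in> chains (del \<Delta> v) k" and b: "b \<in> chains (link \<Delta> v) (k - 1)"
  shows "cone_chain v a b \<in> chains \<Delta> k"
proof -
  have "\<sigma> \<in> \<Delta> \<and> int (card \<sigma>) = k + 1" if nz: "cone_chain v a b \<sigma> \<noteq> 0" for \<sigma>
  proof (cases "v \<in> \<sigma>")
    case True
    then have "\<sigma> - {v} \<in> link \<Delta> v" "int (card (\<sigma> - {v})) = k"
      using nz b by (auto simp: cone_chain_def chains_def)
    moreover have "insert v (\<sigma> - {v}) = \<sigma>" using True by auto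
    ultimately have "\<sigma> \<in> \<Delta>" by (simp add: link_def)
    then have "finite \<sigma>" using \<Delta> by (simp add: simplicial_complex_def)
    then have "card \<sigma> = Suc (card (\<sigma> - {v}))" using True by (simp only: card_Suc_Diff1)
    then show ?thesis using \<open>\<sigma> \<in> \<Delta>\<close> \<open>int (card (\<sigma> - {v})) = k\<close> by simp
  next
    case False
    then show ?thesis using nz a by (auto simp: cone_chain_def chains_def del_def)
  qed
  then show ?thesis by (simp add: chains_def)
qed

lemma cone_chain_surj:
  assumes \<Delta>: "simplicial_complex \<Delta>" and c: "c \<in> chains \<Delta> k"
  obtains a b where "a \<in> chains (del \<Delta> v) k" "b \<in> chains (link \<Delta> v) (k - 1)"
    "c = cone_chain v a b"
proof
  let ?a = "\<lambda>\<sigma>. if v \<in> \<sigma> then 0 else c \<sigma>"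
  let ?b = "\<lambda>\<tau>. if v \<in> \<tau> then 0 else face_sign v \<tau> * c (insert v \<tau>)"
  show "?a \<in> chains (del \<Delta> v) k" using c by (auto simp: chains_def del_def)
  have "\<tau> \<in> link \<Delta> v \<and> int (card \<tau>) = k - 1 + 1" if nz: "?b \<tau> \<noteq> 0" for \<tau>
  proof -
    have v: "v \<notin> \<tau>" "insert v \<tau> \<in> \<Delta>" "int (card (insert v \<tau>)) = k + 1"
      using nz c by (auto simp: chains_def split: if_splits)
    then have "finite (insert v \<tau>)" "\<tau> \<in> \<Delta>"
      using \<Delta> unfolding simplicial_complex_def by (blast, blast)
    then show ?thesis using v by (simp add: link_def del_def)
  qed
  then show "?b \<in> chains (link \<Delta> v) (k - 1)" unfolding chains_def by blast
  show "c = cone_chain v ?a ?b"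
  proof
    fix \<sigma>
    show "c \<sigma> = cone_chain v ?a ?b \<sigma>"
      by (cases "v \<in> \<sigma>") (simp_all add: cone_chain_def face_sign_square insert_absorb)
  qed
qed

lemma cone_chain_inj:
  assumes eq: "cone_chain v a b = cone_chain v a' b'"
    and "a \<in> chains (del \<Delta> v) k" "a' \<in> chains (del \<Delta> v) k"
    and "b \<in> chains (link \<Delta> v) l" "b' \<in> chains (link \<Delta> v) l"
  shows "a = a' \<and> b = b'"
proof (intro conjI ext)
  fix \<sigma>
  have off: "a \<sigma> = 0" "a' \<sigma> = 0" "b \<sigma> = 0" "b' \<sigma> = 0" if "v \<in> \<sigma>"
  proof -
    have "\<sigma> \<notin> del \<Delta> v" "\<sigma> \<notin> link \<Delta> v" using that by (auto simp: link_def del_def)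
    with assms(2-) show "a \<sigma> = 0" "a' \<sigma> = 0" "b \<sigma> = 0" "b' \<sigma> = 0"
      by (simp_all add: chains_outside)
  qed
  show "a \<sigma> = a' \<sigma>"
    using fun_cong[OF eq, of \<sigma>] off by (cases "v \<in> \<sigma>") (simp_all add: cone_chain_def)
  show "b \<sigma> = b' \<sigma>"
  proof (cases "v \<in> \<sigma>")
    case False
    then have "face_sign v \<sigma> * b \<sigma> = face_sign v \<sigma> * b' \<sigma>"
      using fun_cong[OF eq, of "insert v \<sigma>"] by (simp add: cone_chain_def)
    then have "face_sign v \<sigma> * (face_sign v \<sigma> * b \<sigma>) = face_sign v \<sigma> * (face_sign v \<sigma> * b' \<sigma>)"
      by simp
    then show ?thesis by (simp only: face_sign_square)
  qed (simp add: off)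
qed

text \<open>At a face \<open>\<tau>\<close> without \<open>v\<close>, the coface \<open>\<tau> \<union> {v}\<close> contributes \<open>b \<tau>\<close>, where the two signs cancel, and
  the other cofaces give the boundary in the deletion.  At a face \<open>\<rho> \<union> {v}\<close>, the cofaces correspond to
  those of \<open>\<rho>\<close> in the link, and moving \<open>v\<close> past the inserted vertex reverses every sign.\<close>

lemma boundary_cone_chain:
  assumes \<Delta>: "simplicial_complex \<Delta>"
    and b: "b \<in> chains (link \<Delta> v) l"
  shows "boundary \<Delta> (cone_chain v a b) =
    cone_chain v (\<lambda>\<sigma>. boundary (del \<Delta> v) a \<sigma> + b \<sigma>) (\<lambda>\<sigma>. - boundary (link \<Delta> v) b \<sigma>)"
proof
  fix \<tau>
  let ?c = "cone_chain v a b"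
  let ?W = "{w. w \<notin> \<tau> \<and> insert w \<tau> \<in> \<Delta>}"
  let ?f = "\<lambda>w. face_sign w \<tau> * ?c (insert w \<tau>)"
  show "boundary \<Delta> ?c \<tau> =
    cone_chain v (\<lambda>\<sigma>. boundary (del \<Delta> v) a \<sigma> + b \<sigma>) (\<lambda>\<sigma>. - boundary (link \<Delta> v) b \<sigma>) \<tau>"
  proof (cases "v \<in> \<tau>")
    case False
    have W: "?W - {v} = {w. w \<notin> \<tau> \<and> insert w \<tau> \<in> del \<Delta> v}"
      using False by (auto simp: del_def)
    have "boundary \<Delta> ?c \<tau> = (if v \<in> ?W then ?f v else 0) + sum ?f (?W - {v})"
      unfolding boundary_face_sign using sum.remove[OF finite_cofaces[OF \<Delta>], of v \<tau> ?f] by simp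
    also have "(if v \<in> ?W then ?f v else 0) = b \<tau>"
    proof (cases "insert v \<tau> \<in> \<Delta>")
      case True
      then show ?thesis using False by (simp add: cone_chain_def face_sign_square)
    next
      case nf: False
      then show ?thesis using chains_outside[OF b, of \<tau>] by (simp add: link_def)
    qed
    also have "sum ?f (?W - {v}) = boundary (del \<Delta> v) a \<tau>"
      unfolding boundary_face_sign W
      using False by (intro sum.cong) (auto simp: cone_chain_def del_def)
    finally have "boundary \<Delta> ?c \<tau> = b \<tau> + boundary (del \<Delta> v) a \<tau>" .
    then show ?thesis using False by (simp only: cone_chain_def if_False add.commute)
  next
    case True
    define \<rho> where "\<rho> = \<tau> - {v}"
    have \<rho>: "\<tau> = insert v \<rho>" "v \<notin> \<rho>" using True by (auto simp: \<rho>_def)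
    have W: "?W = {w. w \<notin> \<rho> \<and> insert w \<rho> \<in> link \<Delta> v}"
    proof (intro set_eqI iffI)
      fix w assume "w \<in> ?W"
      then have w: "w \<notin> \<tau>" "insert w \<tau> \<in> \<Delta>" by auto
      moreover have "insert w \<rho> \<subseteq> insert w \<tau>" using \<rho> by auto
      ultimately have "insert w \<rho> \<in> \<Delta>" using \<Delta> unfolding simplicial_complex_def by blast
      with w \<rho> show "w \<in> {w. w \<notin> \<rho> \<and> insert w \<rho> \<in> link \<Delta> v}"
        by (auto simp: link_def del_def insert_commute)
    next
      fix w assume "w \<in> {w. w \<notin> \<rho> \<and> insert w \<rho> \<in> link \<Delta> v}"
      then show "w \<in> ?W" using \<rho> by (auto simp: link_def del_def insert_commute)
    qed
    have summand: "?f w = - face_sign v \<rho> * (face_sign w \<rho> * b (insert w \<rho>))" if "w \<in> ?W" for w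
    proof -
      have "w \<noteq> v" "w \<notin> \<rho>" using that \<rho> by auto
      have "finite (insert w \<tau>)" using that \<Delta> by (auto simp: simplicial_complex_def)
      then have "finite \<rho>" using \<rho> by simp
      have "insert w \<tau> - {v} = insert w \<rho>" using \<rho> \<open>w \<noteq> v\<close> by auto
      then have "?f w = (face_sign w (insert v \<rho>) * face_sign v (insert w \<rho>)) * b (insert w \<rho>)"
        using \<rho> by (simp add: cone_chain_def mult.assoc)
      also have "\<dots> = - face_sign v \<rho> * (face_sign w \<rho> * b (insert w \<rho>))"
        unfolding face_sign_swap[OF \<open>w \<noteq> v\<close>[symmetric] \<open>finite \<rho>\<close> \<rho>(2) \<open>w \<notin> \<rho>\<close>]
        by (simp only: mult_minus_left mult.assoc)
      finally show ?thesis .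
    qed
    have "boundary \<Delta> ?c \<tau> = (\<Sum>w\<in>?W. - face_sign v \<rho> * (face_sign w \<rho> * b (insert w \<rho>)))"
      unfolding boundary_face_sign using summand by (intro sum.cong) auto
    also have "\<dots> = - face_sign v \<rho> * boundary (link \<Delta> v) b \<rho>"
      unfolding boundary_face_sign W by (simp add: sum_distrib_left)
    also have "\<dots> = face_sign v (\<tau> - {v}) * - boundary (link \<Delta> v) b (\<tau> - {v})"
      by (simp add: \<rho>_def)
    finally show ?thesis using True by (simp only: cone_chain_def if_True)
  qed
qed

lemma boundary_cone_chainD:
  assumes \<Delta>: "simplicial_complex \<Delta>"
    and a: "a \<in> chains (del \<Delta> v) (k + 1)" and b: "b \<in> chains (link \<Delta> v) k"
    and a': "a' \<in> chains (del \<Delta> v) k" and b': "b' \<in> chains (link \<Delta> v) (k - 1)"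
    and eq: "boundary \<Delta> (cone_chain v a b) = cone_chain v a' b'"
  shows "boundary (del \<Delta> v) a \<sigma> + b \<sigma> = a' \<sigma>" "- boundary (link \<Delta> v) b \<sigma> = b' \<sigma>"
proof -
  let ?p = "\<lambda>\<sigma>. boundary (del \<Delta> v) a \<sigma> + b \<sigma>" and ?q = "\<lambda>\<sigma>. - boundary (link \<Delta> v) b \<sigma>"
  have p: "?p \<in> chains (del \<Delta> v) k"
    by (rule chains_add[OF boundary_chains[OF simplicial_complex_del[OF \<Delta>] a,
          unfolded add_diff_cancel_right'] chains_mono[OF b link_subset_del]])
  have q: "?q \<in> chains (link \<Delta> v) (k - 1)"
    by (rule chains_uminus[OF boundary_chains[OF simplicial_complex_link[OF \<Delta>] b]])
  have pq: "?p = a' \<and> ?q = b'"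
    by (rule cone_chain_inj[OF eq[unfolded boundary_cone_chain[OF \<Delta> b, of a]] p a' q b'])
  show "boundary (del \<Delta> v) a \<sigma> + b \<sigma> = a' \<sigma>" by (rule fun_cong[OF conjunct1[OF pq]])
  show "- boundary (link \<Delta> v) b \<sigma> = b' \<sigma>" by (rule fun_cong[OF conjunct2[OF pq]])
qed

text \<open>A cycle \<open>z\<close> of the link is a boundary \<open>\<partial>a\<close> in the deletion, so \<open>(-a, z)\<close> is a cycle of
  \<open>\<Delta>\<close>.  If \<open>(a', b')\<close> has this cycle as its boundary, then \<open>z = -\<partial>b'\<close>.\<close>

lemma homology_zero_link:
  fixes K :: "'k::field itself"
  assumes \<Delta>: "simplicial_complex \<Delta>"
    and "homology_zero K \<Delta> (k + 1)" "homology_zero K (del \<Delta> v) k"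
  shows "homology_zero K (link \<Delta> v) k"
proof (rule homology_zeroI)
  let ?D = "del \<Delta> v" and ?L = "link \<Delta> v"
  fix z :: "'a set \<Rightarrow> 'k" assume z: "z \<in> chains ?L k" "boundary ?L z = (\<lambda>_. 0)"
  have "boundary ?D z = (\<lambda>_. 0)"
    using boundary_mono[OF simplicial_complex_del[OF \<Delta>] link_subset_del z(1)] z(2) by simp
  then obtain a where a: "a \<in> chains ?D (k + 1)" "boundary ?D a = z"
    by (rule homology_zeroD[OF assms(3) chains_mono[OF z(1) link_subset_del]]) (rule that)
  let ?c = "cone_chain v (\<lambda>\<sigma>. - a \<sigma>) z"
  have "z \<in> chains ?L (k + 1 - 1)" using z(1) by simp
  then have "?c \<in> chains \<Delta> (k + 1)"
    by (rule cone_chain_chains[OF \<Delta> chains_uminus[OF a(1)]])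
  moreover have "boundary \<Delta> ?c = (\<lambda>_. 0)"
    unfolding boundary_cone_chain[OF \<Delta> z(1)] boundary_uminus a(2) z(2)
    by (simp add: cone_chain_zero)
  ultimately obtain e where e: "e \<in> chains \<Delta> (k + 1 + 1)" "boundary \<Delta> e = ?c"
    by (rule homology_zeroD[OF assms(2)]) (rule that)
  obtain a' b' where ab: "a' \<in> chains ?D (k + 1 + 1)" "b' \<in> chains ?L (k + 1)"
      "e = cone_chain v a' b'"
    by (rule cone_chain_surj[OF \<Delta> e(1), of v, unfolded add_diff_cancel_right']) (rule that)
  have "z \<in> chains ?L (k + 1 - 1)" using z(1) by simp
  moreover have "boundary \<Delta> (cone_chain v a' b') = ?c" using e(2) ab(3) by simp
  ultimately have "- boundary ?L b' \<sigma> = z \<sigma>" for \<sigma>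
    by (rule boundary_cone_chainD(2)[OF \<Delta> ab(1,2) chains_uminus[OF a(1)]])
  then have z': "boundary ?L (\<lambda>\<sigma>. - b' \<sigma>) = z" unfolding boundary_uminus by (rule ext)
  show "\<exists>e \<in> chains ?L (k + 1). boundary ?L e = z"
    by (rule bexI[of "\<lambda>e. boundary ?L e = z", OF z' chains_uminus[OF ab(2)]])
qed

text \<open>A cycle \<open>z\<close> of the deletion is a cycle of \<open>\<Delta>\<close>.  Hence it is the boundary of some
  \<open>(a, b)\<close>, which means that \<open>z = \<partial>a + b\<close> and that \<open>b\<close> is a cycle of the link.  Such a \<open>b\<close> is a boundary
  already in the link.\<close>

lemma homology_zero_del:
  fixes K :: "'k::field itself"
  assumes \<Delta>: "simplicial_complex \<Delta>"
    and "homology_zero K \<Delta> k" "homology_zero K (link \<Delta> v) k"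
  shows "homology_zero K (del \<Delta> v) k"
proof (rule homology_zeroI)
  let ?D = "del \<Delta> v" and ?L = "link \<Delta> v"
  fix z :: "'a set \<Rightarrow> 'k" assume z: "z \<in> chains ?D k" "boundary ?D z = (\<lambda>_. 0)"
  let ?c = "cone_chain v z (\<lambda>_. 0)"
  have "?c \<in> chains \<Delta> k" by (rule cone_chain_chains[OF \<Delta> z(1) chains_zero])
  moreover have "boundary \<Delta> ?c = (\<lambda>_. 0)"
    using z(2) by (simp add: boundary_cone_chain[OF \<Delta> chains_zero] boundary_zero cone_chain_zero)
  ultimately obtain e where e: "e \<in> chains \<Delta> (k + 1)" "boundary \<Delta> e = ?c"
    by (rule homology_zeroD[OF assms(2)]) (rule that)
  obtain a b where ab: "a \<in> chains ?D (k + 1)" "b \<in> chains ?L k" "e = cone_chain v a b"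
    by (rule cone_chain_surj[OF \<Delta> e(1), of v]) (rule that, simp_all)
  have "boundary \<Delta> (cone_chain v a b) = ?c" using e(2) ab(3) by simp
  note eq' = boundary_cone_chainD[OF \<Delta> ab(1,2) z(1) chains_zero this]
  have eq: "\<And>\<sigma>. boundary ?D a \<sigma> + b \<sigma> = z \<sigma>" "boundary ?L b = (\<lambda>_. 0)"
    by (rule eq'(1)) (use eq'(2) in \<open>simp add: fun_eq_iff\<close>)
  obtain b' where b': "b' \<in> chains ?L (k + 1)" "boundary ?L b' = b"
    by (rule homology_zeroD[OF assms(3) ab(2) eq(2)]) (rule that)
  have "boundary ?D b' = b"
    using boundary_mono[OF simplicial_complex_del[OF \<Delta>] link_subset_del b'(1)] b'(2) by simp
  then have z': "boundary ?D (\<lambda>\<sigma>. a \<sigma> + b' \<sigma>) = z" by (simp add: boundary_add eq(1))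
  show "\<exists>e \<in> chains ?D (k + 1). boundary ?D e = z"
    by (rule bexI[of "\<lambda>e. boundary ?D e = z", OF z'
        chains_add[OF ab(1) chains_mono[OF b'(1) link_subset_del]]])
qed

text \<open>For a cycle \<open>(a, b)\<close> of \<open>\<Delta>\<close>, the component \<open>b\<close> is a cycle of the link, hence \<open>b = \<partial>b'\<close>.
  Adding the boundary of \<open>(0, b')\<close> turns \<open>(a, b)\<close> into \<open>(a + b', 0)\<close>, where \<open>a + b'\<close> is a cycle
  of the deletion, hence a boundary.\<close>

lemma homology_zero_from_link_del:
  fixes K :: "'k::field itself"
  assumes \<Delta>: "simplicial_complex \<Delta>"
    and "homology_zero K (link \<Delta> v) (k - 1)" "homology_zero K (del \<Delta> v) k"
  shows "homology_zero K \<Delta> k"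
proof (rule homology_zeroI)
  let ?D = "del \<Delta> v" and ?L = "link \<Delta> v"
  fix z :: "'a set \<Rightarrow> 'k" assume z: "z \<in> chains \<Delta> k" "boundary \<Delta> z = (\<lambda>_. 0)"
  obtain a b where ab: "a \<in> chains ?D k" "b \<in> chains ?L (k - 1)" "z = cone_chain v a b"
    by (rule cone_chain_surj[OF \<Delta> z(1), of v]) (rule that)
  have a: "a \<in> chains ?D (k - 1 + 1)" using ab(1) by simp
  have "boundary \<Delta> (cone_chain v a b) = cone_chain v (\<lambda>_. 0) (\<lambda>_. 0)"
    using z(2) ab(3) by (simp add: cone_chain_zero)
  note eq' = boundary_cone_chainD[OF \<Delta> a ab(2) chains_zero chains_zero this]
  have eq: "\<And>\<sigma>. boundary ?D a \<sigma> + b \<sigma> = 0" "boundary ?L b = (\<lambda>_. 0)"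
    by (rule eq'(1)) (use eq'(2) in \<open>simp add: fun_eq_iff\<close>)
  obtain b' where b': "b' \<in> chains ?L k" "boundary ?L b' = b"
    by (rule homology_zeroD[OF assms(2) ab(2) eq(2)]) (rule that, simp_all)
  have b'D: "b' \<in> chains ?D k" by (rule chains_mono[OF b'(1) link_subset_del])
  have "boundary ?D b' = b"
    using boundary_mono[OF simplicial_complex_del[OF \<Delta>] link_subset_del b'(1)] b'(2) by simp
  then have "boundary ?D (\<lambda>\<sigma>. a \<sigma> + b' \<sigma>) = (\<lambda>_. 0)" by (simp add: boundary_add eq(1))
  then obtain a' where a': "a' \<in> chains ?D (k + 1)" "boundary ?D a' = (\<lambda>\<sigma>. a \<sigma> + b' \<sigma>)"
    by (rule homology_zeroD[OF assms(3) chains_add[OF ab(1) b'D]]) (rule that)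
  let ?e = "cone_chain v a' (\<lambda>\<sigma>. - b' \<sigma>)"
  have "(\<lambda>\<sigma>. - b' \<sigma>) \<in> chains ?L (k + 1 - 1)" using chains_uminus[OF b'(1)] by simp
  then have "?e \<in> chains \<Delta> (k + 1)" by (rule cone_chain_chains[OF \<Delta> a'(1)])
  moreover have "boundary \<Delta> ?e = z"
    unfolding boundary_cone_chain[OF \<Delta> chains_uminus[OF b'(1)]] boundary_uminus a'(2) b'(2) ab(3)
    by simp
  ultimately show "\<exists>e \<in> chains \<Delta> (k + 1). boundary \<Delta> e = z" by (intro bexI[of _ ?e])
qed


section \<open>Degrees of spheres under links and deletions\<close>

lemma homology_one_dim_nonzero:
  fixes K :: "'k::field itself" and \<Delta> :: "'a set set"
  assumes "homology_one_dim K \<Delta> k"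
  shows "\<not> homology_zero K \<Delta> k"
proof
  assume "homology_zero K \<Delta> k"
  with assms obtain \<phi> :: "('a set \<Rightarrow> 'k) set \<Rightarrow> 'k"
    where "bij_betw \<phi> {homology_class \<Delta> k (\<lambda>_. 0)} UNIV"
    unfolding homology_one_dim_def homology_zero_def by auto
  then have "(UNIV :: 'k set) = {\<phi> (homology_class \<Delta> k (\<lambda>_. 0))}"
    by (simp add: bij_betw_def)
  then have "(0 :: 'k) = 1" by (metis UNIV_I singletonD)
  then show False by simp
qed

text \<open>A homology sphere has dimension at least \<open>-1\<close> because no face has negative cardinality: every
  chain of smaller degree is zero.\<close>

lemma homology_zero_below:
  fixes K :: "'k::field itself"
  assumes "k < -1"
  shows "homology_zero K \<Delta> k"
proof (rule homology_zeroI)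
  fix c :: "'a set \<Rightarrow> 'k" assume "c \<in> chains \<Delta> k"
  then have "c = (\<lambda>_. 0)" using assms by (auto simp: chains_def fun_eq_iff)
  then show "\<exists>e \<in> chains \<Delta> (k + 1). boundary \<Delta> e = c"
    using boundary_zero by (intro bexI[of _ "\<lambda>_. 0"]) (simp_all add: chains_zero)
qed

lemma sphere_homology_zero_iff:
  assumes "sphere_homology K \<Delta> d"
  shows "homology_zero K \<Delta> j \<longleftrightarrow> j \<noteq> d"
  using assms homology_one_dim_nonzero unfolding sphere_homology_def by blast

lemma spherical_simplicial: "spherical K \<Delta> \<Longrightarrow> simplicial_complex \<Delta>"
  by (erule spherical.cases) simp

text \<open>For a spherical complex, the nonvanishing of a single homology group thus determines all of
  them.\<close>

lemma spherical_sphere_homology: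
  assumes "spherical K \<Delta>" "\<not> homology_zero K \<Delta> d"
  shows "sphere_homology K \<Delta> d"
proof -
  have "(\<forall>i. homology_zero K \<Delta> i \<or> homology_one_dim K \<Delta> i) \<and>
    (\<forall>i j. homology_one_dim K \<Delta> i \<and> homology_one_dim K \<Delta> j \<longrightarrow> i = j)"
    using assms(1) by (rule spherical.cases) simp
  moreover have "d \<ge> -1" using homology_zero_below assms(2) by (meson not_le)
  ultimately show ?thesis using assms(2) unfolding sphere_homology_def by blast
qed

lemma spherical_void:
  fixes K :: "'k::field itself"
  shows "spherical K ({} :: 'a set set)"
proof -
  have "homology_zero K ({} :: 'a set set) i" for i
  proof (rule homology_zeroI)
    fix c :: "'a set \<Rightarrow> 'k" assume "c \<in> chains {} i"
    then have "c = (\<lambda>_. 0)" by (simp add: chains_def fun_eq_iff)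
    then show "\<exists>e \<in> chains {} (i + 1). boundary {} e = c"
      using boundary_zero by (intro bexI[of _ "\<lambda>_. 0"]) (simp_all add: chains_zero)
  qed
  then show ?thesis
    using homology_one_dim_nonzero
    by (intro spherical.intros) (auto simp: simplicial_complex_def vertices_def)
qed

text \<open>Non-vertices are included because a vertex of \<open>\<Delta>\<close> may no longer be one after a link has been
  taken.  For a non-vertex, the link is void and the deletion is the whole complex.\<close>

lemma spherical_link_del:
  assumes "spherical K \<Delta>"
  shows "spherical K (link \<Delta> v)" "spherical K (del \<Delta> v)"
proof -
  note \<Delta> = spherical_simplicial[OF assms]
  have "spherical K (link \<Delta> v) \<and> spherical K (del \<Delta> v)"
  proof (cases "v \<in> vertices \<Delta>")
    case True
    from assms show ?thesis by (rule spherical.cases) (use True in simp)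
  next
    case False
    with assms show ?thesis
      by (simp add: spherical_void link_nonvertex[OF \<Delta>] del_nonvertex[OF \<Delta>])
  qed
  then show "spherical K (link \<Delta> v)" "spherical K (del \<Delta> v)" by blast+
qed

lemma spherical_iterated_link_del: "spherical K \<Delta> \<Longrightarrow> spherical K (link_del X vs \<Delta>)"
  by (induction vs arbitrary: \<Delta>) (auto intro: spherical_link_del)

lemma no_homology_link_iff_del:
  assumes "simplicial_complex \<Delta>" "no_homology K \<Delta>"
  shows "homology_zero K (link \<Delta> v) k \<longleftrightarrow> homology_zero K (del \<Delta> v) k"
proof -
  have "homology_zero K \<Delta> j" for j using assms(2) by (simp add: no_homology_def)
  then show ?thesis
    using homology_zero_link[OF assms(1), of K k v] homology_zero_del[OF assms(1), of K k v] by auto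
qed

text \<open>In any other degree, the long exact sequence gives link and deletion the same homology.  If it is
  nonzero there, both are spherical and hence acyclic in the degrees \<open>d\<close> and \<open>d - 1\<close>, and exactness
  at \<open>H\<^sub>d(\<Delta>)\<close> makes this group vanish.\<close>

lemma sphere_link_del_degree:
  assumes sph: "spherical K \<Delta>" and d: "sphere_homology K \<Delta> d"
    and nz: "\<not> homology_zero K (link \<Delta> v) e \<or> \<not> homology_zero K (del \<Delta> v) e"
  shows "e = d \<or> e = d - 1"
proof (rule ccontr)
  assume e: "\<not> (e = d \<or> e = d - 1)"
  note \<Delta> = spherical_simplicial[OF sph] and zero = sphere_homology_zero_iff[OF d]
  have "homology_zero K (link \<Delta> v) e \<longleftrightarrow> homology_zero K (del \<Delta> v) e"
    using homology_zero_link[OF \<Delta>, of K e v] homology_zero_del[OF \<Delta>, of K e v] e zero by auto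
  with nz have "sphere_homology K (link \<Delta> v) e" "sphere_homology K (del \<Delta> v) e"
    using spherical_sphere_homology spherical_link_del[OF sph] by blast+
  then have "homology_zero K (link \<Delta> v) (d - 1)" "homology_zero K (del \<Delta> v) d"
    using e by (auto simp: sphere_homology_zero_iff)
  then show False using homology_zero_from_link_del[OF \<Delta>, of K v d] zero by simp
qed

text \<open>Again by exactness at \<open>H\<^sub>d(\<Delta>)\<close>.\<close>

lemma sphere_link_or_del_sphere:
  assumes "spherical K \<Delta>" "sphere_homology K \<Delta> d"
  obtains "sphere_homology K (link \<Delta> v) (d - 1)" | "sphere_homology K (del \<Delta> v) d"
proof -
  have "\<not> homology_zero K (link \<Delta> v) (d - 1) \<or> \<not> homology_zero K (del \<Delta> v) d"
    using homology_zero_from_link_del[OF spherical_simplicial[OF assms(1)], of K v d]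
    by (auto simp: sphere_homology_zero_iff[OF assms(2)])
  then show thesis
    using that spherical_sphere_homology spherical_link_del[OF assms(1)] by metis
qed

text \<open>The operation at the first vertex \<open>v\<close> plays two roles.  Commuted to the end, it is the last
  operation, applied to \<open>\<Gamma>\<close>.  If \<open>\<Gamma>\<close> is acyclic, it is the first operation, and it may be exchanged
  between link and deletion so that it produces a sphere; the final homology does not change.  Hence
  the induction hypothesis is needed for all complexes and all \<open>d\<close>.\<close>

lemma iterated_link_del_degree:
  assumes "spherical K \<Delta>" "sphere_homology K \<Delta> d" "distinct vs"
    and "\<not> homology_zero K (link_del X vs \<Delta>) e"
  shows "d - int (length vs) \<le> e \<and> e \<le> d"
  using assms
proof (induction vs arbitrary: \<Delta> d e)
  case Nil
  then show ?case by (simp add: sphere_homology_zero_iff)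
next
  case (Cons v vs)
  define \<Gamma> where "\<Gamma> = link_del X vs \<Delta>"
  have \<Gamma>: "spherical K \<Gamma>"
    unfolding \<Gamma>_def by (rule spherical_iterated_link_del[OF Cons.prems(1)])
  have commute: "link_del X vs (link \<Delta> v) = link \<Gamma> v" "link_del X vs (del \<Delta> v) = del \<Gamma> v"
    using Cons.prems(3) by (simp_all add: \<Gamma>_def link_del_of_link link_del_of_del)
  have nz: "\<not> homology_zero K (link \<Gamma> v) e \<or> \<not> homology_zero K (del \<Gamma> v) e"
    using Cons.prems(4) commute by (auto split: if_splits)
  show ?case
  proof (cases "no_homology K \<Gamma>")
    case False
    then obtain g where g: "\<not> homology_zero K \<Gamma> g" unfolding no_homology_def by blast
    then have "d - int (length vs) \<le> g \<and> g \<le> d"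
      using Cons.IH[OF Cons.prems(1,2)] Cons.prems(3) by (simp add: \<Gamma>_def)
    moreover have "e = g \<or> e = g - 1"
      using sphere_link_del_degree[OF \<Gamma> spherical_sphere_homology[OF \<Gamma> g] nz] .
    ultimately show ?thesis by auto
  next
    case True
    then have both: "\<not> homology_zero K (link \<Gamma> v) e" "\<not> homology_zero K (del \<Gamma> v) e"
      using nz no_homology_link_iff_del[OF spherical_simplicial[OF \<Gamma>]] by blast+
    from Cons.prems(1,2) show ?thesis
    proof (cases rule: sphere_link_or_del_sphere[where v = v])
      case 1
      then show ?thesis
        using Cons.IH[OF spherical_link_del(1)[OF Cons.prems(1)] 1] both(1) commute Cons.prems(3)
        by force
    next
      case 2
      then show ?thesis
        using Cons.IH[OF spherical_link_del(2)[OF Cons.prems(1)] 2] both(2) commute Cons.prems(3)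
        by force
    qed
  qed
qed

theorem theorem3p6:
  fixes \<Delta> \<Sigma> :: "'a set set"
    and X Y :: "'a set"
    and vs :: "'a list"
    and d\<^sub>\<Delta> :: int
  assumes "simplicial_complex \<Delta>"
    and "spherical TYPE('k::field) \<Delta>"
    and "sphere_homology TYPE('k) \<Delta> d\<^sub>\<Delta>"
    and "simplicial_complex \<Sigma>" and "\<Sigma> \<subseteq> \<Delta>"
    and "X \<subseteq> vertices \<Delta>" and "Y \<subseteq> vertices \<Delta>" and "X \<inter> Y = {}"
    and "distinct vs" and "set vs = X \<union> Y"
    and "\<Sigma> = link_del X vs \<Delta>"
  shows "no_homology TYPE('k) \<Sigma> \<or>
    (\<exists>d\<^sub>\<Sigma>. sphere_homology TYPE('k) \<Sigma> d\<^sub>\<Sigma> \<and>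
       d\<^sub>\<Delta> - int (card X) - int (card Y) \<le> d\<^sub>\<Sigma> \<and> d\<^sub>\<Sigma> \<le> d\<^sub>\<Delta>)"
proof (cases "no_homology TYPE('k) \<Sigma>")
  case False
  then obtain e where e: "\<not> homology_zero TYPE('k) \<Sigma> e" unfolding no_homology_def by blast
  have "sphere_homology TYPE('k) \<Sigma> e"
    using e assms(11) spherical_iterated_link_del[OF assms(2)] spherical_sphere_homology by blast
  moreover have "d\<^sub>\<Delta> - int (length vs) \<le> e \<and> e \<le> d\<^sub>\<Delta>"
    using iterated_link_del_degree[OF assms(2,3,9)] e assms(11) by simp
  moreover have "length vs = card X + card Y"
  proof -
    have "finite (X \<union> Y)" using assms(10) by (metis finite_set)
    then show ?thesis
      using distinct_card[OF assms(9)] assms(10) card_Un_disjoint[OF _ _ assms(8)] by simp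
  qed
  ultimately show ?thesis by (intro disjI2 exI[of _ e]) simp
qed simp

end
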